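(* Let $\{X_n:n\geq 1\}$ be a sequence of i.i.d. real random variables on a probability space $(\Omega,\mathcal{F},P)$ with common distribution function $F$. Put $\alpha_F:=\inf\{x\in\mathbb{R}:F(x)>0\}$ and $\omega_F:=\sup\{x\in\mathbb{R}:F(x)<1\}$. Assume that $\alpha_F=0$, that $F$ is strictly increasing on $(\alpha_F,\omega_F)$, that $F(0)=0$, and that the limit $$F^\prime(0+):=\lim_{x\to 0+}\frac{F(x)-F(0)}{x}=\lim_{x\to 0+}\frac{F(x)}{x}$$ exists and belongs to $(0,\infty)$. Then, for every family of positive numbers $\{a_n:n\geq 1\}$ such that $a_n\to 0$ and $a_nn\to\infty$ as $n\to\infty$, the sequence of random variables $\{a_nn\min\{X_1,\ldots,X_n\}:n\geq 1\}$ satisfies the large deviation principle with speed $1/a_n$ and rate function $I_{\mathrm{MD}}:\mathbb{R}\to[0,\infty]$ defined by $$I_{\mathrm{MD}}(x):=\begin{cases}F^\prime(0+)\,x&\text{if }x\in[0,\infty)\\ \infty&\text{otherwise.}\end{cases}$$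
   Context: Large deviation principle (LDP): a speed is a sequence $\{v_n\}$ with $v_n\to\infty$; a rate function on $\mathbb{R}$ is a lower semicontinuous function $I:\mathbb{R}\to[0,\infty]$ (its level sets are not required to be compact in the definition). A sequence $\{Z_n\}$ of real random variables satisfies the LDP with speed $v_n$ and rate function $I$ if $$\limsup_{n\to\infty}\frac{1}{v_n}\log P(Z_n\in C)\leq-\inf_{x\in C}I(x)\quad\text{for all closed sets }C\subset\mathbb{R},$$ $$\liminf_{n\to\infty}\frac{1}{v_n}\log P(Z_n\in O)\geq-\inf_{x\in O}I(x)\quad\text{for all open sets }O\subset\mathbb{R},$$ with the conventions $\log 0=-\infty$ and $\inf\emptyset=\infty$. *)

theory Defs
  imports "HOL-Probability.Probability"
begin

definition left_endpoint :: "(real \<Rightarrow> real) \<Rightarrow> ereal" where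
  "left_endpoint F = (INF x\<in>{x. F x > 0}. ereal x)"

definition right_endpoint :: "(real \<Rightarrow> real) \<Rightarrow> ereal" where
  "right_endpoint F = (SUP x\<in>{x. F x < 1}. ereal x)"

(* Logarithm of a probability, with log 0 = -\<infinity> (the library has ln 0 = 0). *)
definition prob_log :: "real \<Rightarrow> ereal" where
  "prob_log p = (if p \<le> 0 then -\<infinity> else ereal (ln p))"

(* Lower semicontinuous [0,\<infinity>]-valued function; level sets need not be compact. *)
definition rate_function :: "(real \<Rightarrow> ereal) \<Rightarrow> bool" where
  "rate_function I \<longleftrightarrow> (\<forall>x. 0 \<le> I x) \<and> (\<forall>x. I x \<le> Liminf (at x) I)"

(* Sequences are indexed by n \<ge> 1; values at n = 0 are irrelevant. In ereal the infimum over the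
   empty set is \<infinity>. *)
definition (in prob_space) satisfies_LDP ::
    "(nat \<Rightarrow> 'a \<Rightarrow> real) \<Rightarrow> (nat \<Rightarrow> real) \<Rightarrow> (real \<Rightarrow> ereal) \<Rightarrow> bool" where
  "satisfies_LDP Z v I \<longleftrightarrow>
     (\<forall>n\<ge>1. random_variable borel (Z n)) \<and>
     filterlim v at_top sequentially \<and>
     rate_function I \<and>
     (\<forall>C. closed C \<longrightarrow>
        limsup (\<lambda>n. ereal (1 / v n) * prob_log (prob {w \<in> space M. Z n w \<in> C}))
          \<le> - (INF x\<in>C. I x)) \<and>
     (\<forall>U. open U \<longrightarrow>
        liminf (\<lambda>n. ereal (1 / v n) * prob_log (prob {w \<in> space M. Z n w \<in> U}))
          \<ge> - (INF x\<in>U. I x))"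

definition I_MD :: "real \<Rightarrow> real \<Rightarrow> ereal" where
  "I_MD c x = (if x \<ge> 0 then ereal (c * x) else \<infinity>)"

end

theory Submission
  imports Defs
begin

text \<open>
  Write \<open>c = F'(0+)\<close> and \<open>Z\<close> for the rescaled minimum. By independence
  \<open>P(Z > x) = (1 - F(x / (a n)))^n\<close>, where \<open>a\<close> depends on \<open>n\<close>, so \<open>a ln P(Z > x)\<close> tends to \<open>- c x\<close>
  for every \<open>x \<ge> 0\<close>, while \<open>Z > 0\<close> almost surely. These tails decide everything: the upper bound
  compares a set with a half-line, and the lower bound isolates a half-open interval, whose
  probability is a difference of two tails of different exponential order.
\<close>

section \<open>Lower semicontinuity of the rate function\<close>

lemma ereal_le_uminus_swap: "(x::ereal) \<le> - y \<longleftrightarrow> y \<le> - x"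
  by (cases x; cases y) auto

lemma I_MD_ge: "ereal (c * x) \<le> I_MD c x"
  by (simp add: I_MD_def)

text \<open>The continuous function \<open>c * z\<close> lies below \<open>I_MD c\<close> and agrees
  with it on the nonnegative half-line, which gives semicontinuity there, including at the jump at
  0. Around a negative point the value is constantly infinite.\<close>

lemma rate_function_I_MD:
  assumes "0 < c"
  shows "rate_function (I_MD c)"
  unfolding rate_function_def
proof (intro conjI allI)
  fix x
  show "0 \<le> I_MD c x" using assms by (simp add: I_MD_def)
  show "I_MD c x \<le> Liminf (at x) (I_MD c)"
  proof (cases "x \<ge> 0")
    case True
    have "((\<lambda>z. ereal (c * z)) \<longlongrightarrow> ereal (c * x)) (at x)"
      by (intro tendsto_intros)
    then have "Liminf (at x) (\<lambda>z. ereal (c * z)) = ereal (c * x)"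
      by (intro lim_imp_Liminf) auto
    moreover have "Liminf (at x) (\<lambda>z. ereal (c * z)) \<le> Liminf (at x) (I_MD c)"
      by (intro Liminf_mono always_eventually allI I_MD_ge)
    ultimately show ?thesis using True by (simp add: I_MD_def)
  next
    case False
    then have "\<forall>\<^sub>F z in at x. z < 0"
      by (intro eventually_at_in_open'[of "{..<0}", simplified]) auto
    then have "\<forall>\<^sub>F z in at x. \<infinity> \<le> I_MD c z"
      by eventually_elim (simp add: I_MD_def)
    then have "\<infinity> \<le> Liminf (at x) (I_MD c)" by (rule Liminf_bounded)
    then show ?thesis by simp
  qed
qed

section \<open>Exponential decay of the tails of the minimum\<close>

lemma tendsto_zero_of_ratio:
  fixes F :: "real \<Rightarrow> real"
  assumes "((\<lambda>s. F s / s) \<longlongrightarrow> c) (at_right 0)"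
  shows "(F \<longlongrightarrow> 0) (at_right 0)"
proof -
  have "((\<lambda>s. F s / s * s) \<longlongrightarrow> c * 0) (at_right 0)"
    by (intro tendsto_mult assms tendsto_ident_at)
  moreover have "\<forall>\<^sub>F s in at_right 0. F s / s * s = F s"
    using eventually_at_right_less[of "0::real"] by eventually_elim simp
  ultimately show ?thesis
    by (simp add: Lim_transform_eventually)
qed

text \<open>A chain rule at 0: the quotient splits as \<open>ln (1 - F s) / F s\<close> times
  \<open>F s / s\<close>, and the first factor is a difference quotient of
  \<open>ln (1 - u)\<close>, whose derivative at 0 is -1.\<close>

lemma tendsto_ln_one_minus_over_id:
  fixes F :: "real \<Rightarrow> real"
  assumes "((\<lambda>s. F s / s) \<longlongrightarrow> c) (at_right 0)" and "0 < c"
  shows "((\<lambda>s. ln (1 - F s) / s) \<longlongrightarrow> - c) (at_right 0)"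
proof -
  \<comment> \<open>The limit in \<open>u\<close> is taken over a punctured neighbourhood of 0, so
    substituting \<open>u = F s\<close> requires \<open>F s\<close> to avoid 0; this follows from
    \<open>F s / s\<close> having a positive limit.\<close>
  have Fne: "\<forall>\<^sub>F s in at_right 0. F s \<noteq> 0"
    using order_tendstoD(1)[OF assms] by eventually_elim auto
  have "((\<lambda>u::real. ln (1 - u)) has_real_derivative - 1) (at 0)"
    by (auto intro!: derivative_eq_intros)
  then have "((\<lambda>u::real. ln (1 - u) / u) \<longlongrightarrow> - 1) (at 0)"
    by (simp add: DERIV_def)
  then have "((\<lambda>s. ln (1 - F s) / F s) \<longlongrightarrow> - 1) (at_right 0)"
    by (rule filterlim_compose)
      (use tendsto_zero_of_ratio[OF assms(1)] Fne in \<open>simp add: filterlim_at\<close>)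
  then have "((\<lambda>s. ln (1 - F s) / F s * (F s / s)) \<longlongrightarrow> - 1 * c) (at_right 0)"
    using assms(1) by (rule tendsto_mult)
  moreover have "\<forall>\<^sub>F s in at_right 0. ln (1 - F s) / F s * (F s / s) = ln (1 - F s) / s"
    using Fne by eventually_elim simp
  ultimately have "((\<lambda>s. ln (1 - F s) / s) \<longlongrightarrow> - 1 * c) (at_right 0)"
    by (rule Lim_transform_eventually)
  then show ?thesis by simp
qed

lemma filterlim_divide_at_right_0:
  fixes b :: "nat \<Rightarrow> real"
  assumes "filterlim b at_top sequentially" and "0 < x"
  shows "filterlim (\<lambda>n. x / b n) (at_right 0) sequentially"
proof -
  have bpos: "\<forall>\<^sub>F n in sequentially. b n > 0"
    using assms(1) by (rule filterlim_at_top_dense[THEN iffD1, rule_format])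
  have "(\<lambda>n. x / b n) \<longlonglongrightarrow> 0"
    by (rule tendsto_divide_0[OF tendsto_const filterlim_at_top_imp_at_infinity[OF assms(1)]])
  moreover have "\<forall>\<^sub>F n in sequentially. x / b n \<in> {0<..} \<and> x / b n \<noteq> 0"
    using bpos by eventually_elim (use assms(2) in simp)
  ultimately show ?thesis
    by (simp add: filterlim_at)
qed

text \<open>The preceding limit is evaluated along \<open>s = x / b n\<close> and multiplied by
  \<open>x\<close>. The case \<open>x = 0\<close> stands apart because \<open>at_right 0\<close>
  excludes \<open>s = 0\<close>; there every term is 0.\<close>

lemma tendsto_scaled_ln_tail:
  fixes F :: "real \<Rightarrow> real" and b :: "nat \<Rightarrow> real"
  assumes "((\<lambda>s. F s / s) \<longlongrightarrow> c) (at_right 0)" and "0 < c" and "F 0 = 0"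
    and "filterlim b at_top sequentially" and "0 \<le> x"
  shows "(\<lambda>n. b n * ln (1 - F (x / b n))) \<longlonglongrightarrow> - (c * x)"
proof (cases "x = 0")
  case True
  then show ?thesis using assms(3) by simp
next
  case False
  with assms(5) have x: "x > 0" by simp
  have bpos: "\<forall>\<^sub>F n in sequentially. b n > 0"
    using assms(4) by (rule filterlim_at_top_dense[THEN iffD1, rule_format])
  note lim = filterlim_divide_at_right_0[OF assms(4) x]
  from filterlim_compose[OF tendsto_ln_one_minus_over_id[OF assms(1,2)] lim]
  have "(\<lambda>n. x * (ln (1 - F (x / b n)) / (x / b n))) \<longlonglongrightarrow> x * (- c)"
    by (intro tendsto_mult tendsto_const)
  moreover have "\<forall>\<^sub>F n in sequentially.
      x * (ln (1 - F (x / b n)) / (x / b n)) = b n * ln (1 - F (x / b n))"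
    using bpos by eventually_elim (use x in simp)
  ultimately have "(\<lambda>n. b n * ln (1 - F (x / b n))) \<longlonglongrightarrow> x * (- c)"
    by (rule Lim_transform_eventually)
  then show ?thesis by (simp add: mult.commute)
qed

text \<open>The minimum exceeds \<open>t\<close> exactly when all of the variables do, so
  independence turns the probability into a product of equal factors.\<close>

lemma (in prob_space) prob_Min_greater:
  fixes X :: "nat \<Rightarrow> 'a \<Rightarrow> real"
  assumes indep: "indep_vars (\<lambda>_. borel) X {1..}"
    and cdf: "\<forall>n\<ge>1. cdf (distr M borel (X n)) = F" and n: "n \<ge> 1"
  shows "prob {w \<in> space M. t < (MIN i\<in>{1..n}. X i w)} = (1 - F t) ^ n"
proof -
  have rv: "X i \<in> borel_measurable M" if "i \<ge> 1" for i
    using indep that by (auto simp: indep_vars_def)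
  have "prob (\<Inter>i\<in>{1..n}. X i -` {t<..} \<inter> space M)
      = (\<Prod>i\<in>{1..n}. prob (X i -` {t<..} \<inter> space M))"
    by (rule indep_varsD[OF indep]) (use n in auto)
  also have "(\<Inter>i\<in>{1..n}. X i -` {t<..} \<inter> space M)
      = {w \<in> space M. t < (MIN i\<in>{1..n}. X i w)}"
    using n by (auto simp: Min_gr_iff)
  also have "(\<Prod>i\<in>{1..n}. prob (X i -` {t<..} \<inter> space M)) = (\<Prod>i\<in>{1..n}. 1 - F t)"
  proof (rule prod.cong)
    fix i assume i: "i \<in> {1..n}"
    then have [measurable]: "X i \<in> borel_measurable M" using rv by simp
    interpret D: prob_space "distr M borel (X i)" by (rule prob_space_distr) simp
    have "prob (X i -` {t<..} \<inter> space M) = measure (distr M borel (X i)) {t<..}"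
      by (simp add: measure_distr)
    also have "\<dots> = 1 - measure (distr M borel (X i)) {..t}"
      using D.prob_compl[of "{..t}"] by (simp add: Compl_eq_Diff_UNIV[symmetric])
    also have "\<dots> = 1 - F t" using cdf i by (auto simp: cdf_def)
    finally show "prob (X i -` {t<..} \<inter> space M) = 1 - F t" .
  qed simp
  finally show ?thesis by simp
qed

section \<open>From tail asymptotics to the large deviation principle\<close>

lemma scaled_prob_log_mono:
  assumes "0 \<le> r" and "p \<le> q"
  shows "ereal r * prob_log p \<le> ereal r * prob_log q"
  using assms by (auto intro!: ereal_mult_left_mono simp: prob_log_def)

text \<open>A reduction in which the minimum no longer appears: what enters about the law of
  \<open>Z n\<close> is almost sure positivity and the exponential rate of the tails.\<close>

lemma (in prob_space) satisfies_LDP_I_MD_of_tails: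
  fixes Z :: "nat \<Rightarrow> 'a \<Rightarrow> real" and a :: "nat \<Rightarrow> real"
  assumes c: "0 < c"
    and rv: "\<forall>n\<ge>1. random_variable borel (Z n)"
    and apos: "\<forall>n\<ge>1. a n > 0" and a0: "a \<longlonglongrightarrow> 0"
    and nonneg: "\<And>n. n \<ge> 1 \<Longrightarrow> prob {w \<in> space M. 0 < Z n w} = 1"
    and tail_pos: "\<And>x. 0 \<le> x \<Longrightarrow> \<forall>\<^sub>F n in sequentially. 0 < prob {w \<in> space M. x < Z n w}"
    and tail: "\<And>x. 0 \<le> x \<Longrightarrow>
      (\<lambda>n. a n * ln (prob {w \<in> space M. x < Z n w})) \<longlonglongrightarrow> - (c * x)"
  shows "satisfies_LDP Z (\<lambda>n. 1 / a n) (I_MD c)"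
  unfolding satisfies_LDP_def
proof (intro conjI allI impI)
  have ev1: "\<forall>\<^sub>F n in sequentially. n \<ge> (1::nat)" by (rule eventually_ge_at_top)
  have evpos: "\<forall>\<^sub>F n in sequentially. a n > 0"
    using ev1 by eventually_elim (use apos in auto)
  have inf: "filterlim (\<lambda>n. 1 / a n) at_top sequentially"
    using filterlim_inverse_at_top[OF a0 evpos] by (simp add: inverse_eq_divide)
  show "filterlim (\<lambda>n. 1 / a n) at_top sequentially" by (fact inf)
  show "random_variable borel (Z n)" if "1 \<le> n" for n using rv that by simp
  show "rate_function (I_MD c)" using c by (rule rate_function_I_MD)
  define T where "T x n = prob {w \<in> space M. x < Z n w}" for x n
  \<comment> \<open>The factor \<open>1 / (1 / a n)\<close> is the reciprocal speed as it stands in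
    the definition. Eventual positivity of the tail allows \<open>ln\<close> to be exchanged for
    \<open>prob_log\<close>, since the two differ at 0.\<close>
  have tail': "(\<lambda>n. ereal (1 / (1 / a n)) * prob_log (T x n)) \<longlonglongrightarrow> ereal (- (c * x))"
    if "0 \<le> x" for x
  proof -
    have "\<forall>\<^sub>F n in sequentially.
        ereal (a n * ln (T x n)) = ereal (1 / (1 / a n)) * prob_log (T x n)"
      using tail_pos[OF that] unfolding T_def
      by eventually_elim (simp add: prob_log_def)
    moreover have "(\<lambda>n. ereal (a n * ln (T x n))) \<longlonglongrightarrow> ereal (- (c * x))"
      using tail[OF that] unfolding T_def by (intro tendsto_ereal)
    ultimately show ?thesis by (rule Lim_transform_eventually[rotated])
  qed
  show "limsup (\<lambda>n. ereal (1 / (1 / a n)) * prob_log (prob {w \<in> space M. Z n w \<in> C}))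
      \<le> - (INF x\<in>C. I_MD c x)" (is "limsup ?f \<le> - ?L")
    if "closed C" for C :: "real set"
  proof -
    have [measurable]: "C \<in> sets borel" using that by simp
    \<comment> \<open>Testing levels \<open>t\<close> strictly below the infimum treats finite and
      infinite infima alike, including the empty set and sets of negative numbers.\<close>
    have "?L \<le> - limsup ?f"
    proof (rule dense_le)
      fix t assume t: "t < ?L"
      show "t \<le> - limsup ?f"
      proof (cases t)
        case (real r)
        \<comment> \<open>The rate \<open>c * z\<close> reaches the level \<open>r\<close> at
          \<open>r / c\<close>; the truncation at 0 keeps \<open>y\<close> in the range of the tail
          estimate when \<open>r\<close> is negative.\<close>
        define y where "y = max 0 (r / c)"
        have y: "0 \<le> y" "r \<le> c * y"
          using c by (auto simp: y_def max_def field_simps)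
        have C_gt: "z > y" if "z \<in> C" "z > 0" for z
        proof -
          have "ereal r < I_MD c z"
            using t real that(1) by (auto intro: less_le_trans INF_lower)
          then show ?thesis
            using that(2) c by (auto simp: I_MD_def y_def field_simps)
        qed
        have le_tail: "prob {w \<in> space M. Z n w \<in> C} \<le> T y n" if n: "n \<ge> 1" for n
        proof -
          have [measurable]: "Z n \<in> borel_measurable M" using rv n by simp
          \<comment> \<open>Points of \<open>C\<close> outside the positive half-line are almost
            surely not hit, and the remaining ones lie beyond \<open>y\<close>.\<close>
          have "AE w in M. 0 < Z n w"
            using nonneg[OF n] by (subst (asm) prob_Collect_eq_1) auto
          then have "AE w in M. w \<in> {w \<in> space M. Z n w \<in> C} \<longrightarrow> w \<in> {w \<in> space M. y < Z n w}"
            by eventually_elim (use C_gt in auto)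
          then show ?thesis
            unfolding T_def by (rule finite_measure_mono_AE) simp
        qed
        have "\<forall>\<^sub>F n in sequentially. ?f n \<le> ereal (1 / (1 / a n)) * prob_log (T y n)"
          using ev1 evpos by eventually_elim (intro scaled_prob_log_mono le_tail, auto)
        then have "limsup ?f \<le> limsup (\<lambda>n. ereal (1 / (1 / a n)) * prob_log (T y n))"
          by (rule Limsup_mono)
        also have "\<dots> = ereal (- (c * y))"
          by (rule lim_imp_Limsup[OF sequentially_bot tail'[OF y(1)]])
        also have "\<dots> \<le> - t" using y(2) real by simp
        finally show ?thesis by (rule ereal_le_uminus_swap[THEN iffD1])
      qed (use t in auto)
    qed
    then show ?thesis by (rule ereal_le_uminus_swap[THEN iffD1])
  qed
  show "- (INF x\<in>U. I_MD c x)
      \<le> liminf (\<lambda>n. ereal (1 / (1 / a n)) * prob_log (prob {w \<in> space M. Z n w \<in> U}))"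
    (is "_ \<le> liminf ?f") if U: "open U" for U :: "real set"
  proof -
    have [measurable]: "U \<in> sets borel" using U by simp
    have "- liminf ?f \<le> I_MD c x" if xU: "x \<in> U" for x
    proof (cases "0 \<le> x")
      case False
      then show ?thesis by (simp add: I_MD_def)
    next
      case x: True
      obtain e where e: "e > 0" "ball x e \<subseteq> U"
        using U xU by (meson open_contains_ball)
      \<comment> \<open>The interval starts at \<open>x\<close> itself, so its exponent is exactly
        \<open>- (c * x)\<close> with no loss; halving \<open>e\<close> keeps the right end inside
        the ball.\<close>
      define z where "z = x + e / 2"
      have z: "x < z" "0 \<le> z" and zU: "{x<..z} \<subseteq> U"
        using e x by (auto simp: z_def dist_real_def subset_iff)
      \<comment> \<open>Half the distance between the exponents at \<open>x\<close> and
        \<open>z\<close>, so that the scaled logarithms eventually differ by more than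
        \<open>d\<close>.\<close>
      define d where "d = c * (z - x) / 2"
      have d: "d > 0" "- (c * z) - - (c * x) < - d"
        using c z by (auto simp: d_def field_simps)
      have "(\<lambda>n. a n * ln (T z n) - a n * ln (T x n)) \<longlonglongrightarrow> - (c * z) - - (c * x)"
        unfolding T_def by (intro tendsto_diff tail z x)
      from order_tendstoD(2)[OF this d(2)]
      have gap: "\<forall>\<^sub>F n in sequentially. a n * ln (T z n) - a n * ln (T x n) < - d" .
      \<comment> \<open>This says \<open>a n * ln 2 < d\<close>: the gap then exceeds the scaled
        cost of a factor 2, so the tail at \<open>z\<close> is less than half the tail at
        \<open>x\<close> and the interval retains at least the other half.\<close>
      have large: "\<forall>\<^sub>F n in sequentially. ln 2 / d < 1 / a n"
        using inf by (rule filterlim_at_top_dense[THEN iffD1, rule_format])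
      have "\<forall>\<^sub>F n in sequentially. ereal (a n * ln (T x n) - a n * ln 2) \<le> ?f n"
        using gap large evpos ev1 tail_pos[OF x] tail_pos[OF z(2)]
      proof eventually_elim
        case (elim n)
        have [measurable]: "Z n \<in> borel_measurable M" using rv elim by simp
        have pos: "0 < T x n" "0 < T z n" using elim by (auto simp: T_def)
        have "a n * ln 2 < d" using elim d by (simp add: field_simps)
        then have "a n * ln (T z n) < a n * (ln (T x n) - ln 2)"
          using elim by (simp add: algebra_simps)
        then have "ln (T z n) < ln (T x n / 2)"
          using elim pos by (simp add: ln_div)
        then have half: "T z n < T x n / 2" using pos by simp
        have "T x n \<le> prob ({w \<in> space M. Z n w \<in> U} \<union> {w \<in> space M. z < Z n w})"
          unfolding T_def using zU by (intro finite_measure_mono) (auto simp: subset_iff not_less)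
        also have "\<dots> \<le> prob {w \<in> space M. Z n w \<in> U} + T z n"
          unfolding T_def by (intro measure_Un_le) auto
        finally have "T x n / 2 \<le> prob {w \<in> space M. Z n w \<in> U}" using half by simp
        then have "ereal (1 / (1 / a n)) * prob_log (T x n / 2) \<le> ?f n"
          using elim by (intro scaled_prob_log_mono) auto
        then show ?case
          using pos by (simp add: prob_log_def ln_div algebra_simps)
      qed
      then have "liminf (\<lambda>n. ereal (a n * ln (T x n) - a n * ln 2)) \<le> liminf ?f"
        by (rule Liminf_mono)
      \<comment> \<open>The factor 2 given up above costs \<open>a n * ln 2\<close>, which vanishes
        in the limit.\<close>
      moreover have "(\<lambda>n. a n * ln (T x n) - a n * ln 2) \<longlonglongrightarrow> - (c * x) - 0 * ln 2"
        unfolding T_def by (intro tendsto_diff tail x tendsto_mult a0 tendsto_const)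
      then have "liminf (\<lambda>n. ereal (a n * ln (T x n) - a n * ln 2)) = ereal (- (c * x) - 0 * ln 2)"
        by (intro lim_imp_Liminf tendsto_ereal) auto
      ultimately show ?thesis
        using x by (simp add: I_MD_def ereal_uminus_le_reorder)
    qed
    then have "- liminf ?f \<le> (INF x\<in>U. I_MD c x)" by (rule INF_greatest)
    then show ?thesis by (simp add: ereal_uminus_le_reorder)
  qed
qed

section \<open>Application to minima of independent variables\<close>

theorem proposition3p1:
  fixes M :: "'a measure" and X :: "nat \<Rightarrow> 'a \<Rightarrow> real" and F :: "real \<Rightarrow> real"
    and F'0 :: real and a :: "nat \<Rightarrow> real"
  assumes "prob_space M"
    and "prob_space.indep_vars M (\<lambda>_. borel) X {1..}"
    and "\<forall>n\<ge>1. cdf (distr M borel (X n)) = F"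
    and "left_endpoint F = 0"
    and "strict_mono_on (einterval (left_endpoint F) (right_endpoint F)) F"
    and "F 0 = 0"
    and "((\<lambda>x. (F x - F 0) / x) \<longlongrightarrow> F'0) (at_right 0)"
    and "0 < F'0"
    and "\<forall>n\<ge>1. a n > 0"
    and "a \<longlonglongrightarrow> 0"
    and "filterlim (\<lambda>n. a n * real n) at_top sequentially"
  shows "prob_space.satisfies_LDP M
           (\<lambda>n w. a n * real n * (MIN i\<in>{1..n}. X i w)) (\<lambda>n. 1 / a n) (I_MD F'0)"
proof -
  interpret prob_space M by fact
  note indep = assms(2) and cdf = assms(3) and apos = assms(9)
  define b where "b n = a n * real n" for n
  define Z where "Z n w = b n * (MIN i\<in>{1..n}. X i w)" for n w
  have bpos: "b n > 0" if "n \<ge> 1" for n using apos that by (simp add: b_def)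
  have b_top: "filterlim b at_top sequentially"
    using assms(11) by (simp add: b_def[abs_def])
  have F_lim: "((\<lambda>s. F s / s) \<longlongrightarrow> F'0) (at_right 0)" using assms(6,7) by simp
  note tail_lim = tendsto_scaled_ln_tail[OF F_lim assms(8,6) b_top]
  have tail_eq: "prob {w \<in> space M. x < Z n w} = (1 - F (x / b n)) ^ n" if "n \<ge> 1" for x n
    using prob_Min_greater[OF indep cdf that, of "x / b n"] bpos[OF that]
    by (simp add: Z_def field_simps)
  have tail_pos: "\<forall>\<^sub>F n in sequentially. 0 < prob {w \<in> space M. x < Z n w}" if "0 \<le> x" for x
  proof -
    have "\<forall>\<^sub>F n in sequentially. F (x / b n) < 1"
    proof (cases "x = 0")
      case False
      with that have "filterlim (\<lambda>n. x / b n) (at_right 0) sequentially"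
        by (intro filterlim_divide_at_right_0[OF b_top]) simp
      from filterlim_compose[OF tendsto_zero_of_ratio[OF F_lim] this] show ?thesis
        by (rule order_tendstoD) simp
    qed (simp add: assms(6))
    then show ?thesis
      using eventually_ge_at_top[of 1] by eventually_elim (simp add: tail_eq)
  qed
  have "satisfies_LDP Z (\<lambda>n. 1 / a n) (I_MD F'0)"
  proof (rule satisfies_LDP_I_MD_of_tails)
    show "\<forall>n\<ge>1. random_variable borel (Z n)"
    proof (intro allI impI)
      fix n :: nat assume "n \<ge> 1"
      have [measurable]: "X i \<in> borel_measurable M" if "i \<in> {1..n}" for i
        using indep that by (auto simp: indep_vars_def)
      show "random_variable borel (Z n)" unfolding Z_def by measurable
    qed
    show "prob {w \<in> space M. 0 < Z n w} = 1" if "n \<ge> 1" for n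
      using tail_eq[OF that, of 0] assms(6) by simp
    show "(\<lambda>n. a n * ln (prob {w \<in> space M. x < Z n w})) \<longlonglongrightarrow> - (F'0 * x)" if "0 \<le> x" for x
    \<comment> \<open>The logarithm brings down the exponent \<open>n\<close>, and
      \<open>a n * real n\<close> is \<open>b n\<close>.\<close>
    proof (rule Lim_transform_eventually[OF tail_lim[OF that]])
      show "\<forall>\<^sub>F n in sequentially. b n * ln (1 - F (x / b n))
          = a n * ln (prob {w \<in> space M. x < Z n w})"
        using tail_pos[OF that] eventually_ge_at_top[of 1]
        by eventually_elim (auto simp: tail_eq b_def ln_realpow)
    qed
  qed (use assms(8-10) tail_pos in auto)
  then show ?thesis by (simp add: Z_def[abs_def] b_def)
qed

end
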